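(* Let $\bar y=(\bar y_p^r)$ be a given solution of the relaxed Benders master problem (RxBMP), and fix an airport $a\in A$ and a gate type $t\in T_a$. Let $$X_{a,t}=\{x\ :\ Ax=b_{\bar y},\ \mathbf 1^Tx\le n_{a,t},\ x\succeq 0\},\qquad \bar X_{a,t}=\{\bar x\ :\ \bar A\bar x=b_{\bar y},\ \mathbf 1^T\bar x\le n_{a,t},\ \bar x\succeq 0\},$$ where $A$ is the matrix whose columns correspond to all gate patterns $p\in P^{a,t}$ and $\bar A$ is the matrix composed of the columns of $A$ corresponding to a subset $\bar P^{a,t}\subseteq P^{a,t}$. Suppose $\bar X_{a,t}$ is empty. Let $\bar\lambda$ and $\bar\delta$ denote the (optimal) dual variables corresponding to $\bar A\bar x=b_{\bar y}$ and $\mathbf 1^T\bar x\le n_{a,t}$, respectively, in the phase one optimization problem P1LR-RtBSP, and let $$\hat\delta=\max\Bigl\{\bar\delta,\ \max\{\bar\lambda^T\alpha\ :\ \alpha\in col(A)\setminus col(\bar A)\}\Bigr\}.$$ If $\bar\lambda^Tb_{\bar y}-n_{a,t}\hat\delta>0$, then $X_{a,t}$ is empty and the Benders subproblem (BSP) related to $\bar y$ is infeasible.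
   Context: All sets are finite. $\succeq$ is componentwise inequality, $\mathbf 1$ is the all-ones vector, $col(M)$ is the set of columns of a matrix $M$. The maximum over an empty set is omitted (so $\hat\delta=\bar\delta$ if $col(A)\setminus col(\bar A)=\emptyset$). **Sets.** $S$: time slots. $F$: original flights; $FC$: flight copies; $FC_j$: copies of flight $j\in F$ ($FC$ is the disjoint union of the $FC_j$). $E\subseteq FC\times FC$: feasible connections $(i_u,j_v)$ between flight copies. $R$: aircraft; $P^r$: feasible routes (sequences of flight copies) of $r\in R$. $A$ (as index set): airports; $T_a$: gate types at airport $a$; $P^{a,t}$: gate patterns (sequences of flight copy departure/arrival activities at $a$ serviced by one gate) at airport $a$ with gate type $t$. $FC^{a,t}_{dep}$, $FC^{a,t}_{arr}$: flight copies departing from / arriving at $a$ with gate type $t$; $E^{a,t}\subseteq E$: connections at airport $a$ with gate type $t$. The families $(FC^{a,t}_{dep})_{a,t}$ and $(FC^{a,t}_{arr})_{a,t}$ each partition $FC$, and $(E^{a,t})_{a,t}$ partitions $E$; a pattern in $P^{a,t}$ contains only departures of copies in $FC^{a,t}_{dep}$, arrivals of copies in $FC^{a,t}_{arr}$ and connections in $E^{a,t}$. **Parameters.** $u_{sdep},u_{sarr}$: slot capacities; $d_j$: cancellation costs; $c_p^r$: route costs; $c_{a,t}$: cost of a gate pattern; $n_{a,t}$: number of gates of type $t$ at $a$. The following are $0/1$ indicators: $a^r_{p,j_v}$: copy $j_v$ is in route $p\in P^r$; $a^{r,sdep}_{p,j_v}$ / $a^{r,sarr}_{p,j_v}$: $j_v$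 is in route $p$ and departs/arrives in slot $s$; $b^r_{p,(i_u,j_v)}$: connection $(i_u,j_v)$ is in route $p$ (i.e. $i_u,j_v$ are consecutive in $p$); $a^{a,t}_{p,j_v dep}$ / $a^{a,t}_{p,j_v arr}$: the departure/arrival activity of $j_v$ is in pattern $p\in P^{a,t}$; $b^{a,t}_{p,(i_u,j_v)}$: connection $(i_u,j_v)$ is in pattern $p\in P^{a,t}$ (arrival of $i_u$ immediately followed by departure of $j_v$; in particular both activities are in $p$). **RxBMP.** Minimize $\sum_jd_jz_j+\sum_{r}\sum_{p\in P^r}c_p^ry_p^r+q$ over $z_j,y_p^r\in\{0,1\}$, $q\ge0$ subject to: $\sum_{r\in R}\sum_{p\in P^r}\sum_{j_v\in FC_j}a^r_{p,j_v}y_p^r+z_j=1$ for all $j\in F$; $\sum_{r}\sum_{p\in P^r}\sum_{j}\sum_{j_v\in FC_j}a^{r,sdep}_{p,j_v}y_p^r\le u_{sdep}$ and $\sum_{r}\sum_{p\in P^r}\sum_{j}\sum_{j_v\in FC_j}a^{r,sarr}_{p,j_v}y_p^r\le u_{sarr}$ for all $s\in S$; $\sum_{p\in P^r}y_p^r\le1$ for all $r\in R$; and some finite collection of Benders cuts (linear inequalities in $y$ and $q$). **BSP related to $\bar y$.** Minimize $\sum_{a}\sum_{t\in T_a}\sum_{p\in P^{a,t}}c_{a,t}w_p^{a,t}$ over $w_p^{a,t}\in\{0,1\}$ subject to: $\sum_{a}\sum_{t\in T_a}\sum_{p\in P^{a,t}}a^{a,t}_{p,j_v dep}w_p^{a,t}=\sum_{r}\sum_{p\in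 P^r}a^r_{p,j_v}\bar y_p^r$ and $\sum_{a}\sum_{t\in T_a}\sum_{p\in P^{a,t}}a^{a,t}_{p,j_v arr}w_p^{a,t}=\sum_{r}\sum_{p\in P^r}a^r_{p,j_v}\bar y_p^r$ for all $j\in F$, $j_v\in FC_j$; $\sum_{a}\sum_{t\in T_a}\sum_{p\in P^{a,t}}b^{a,t}_{p,(i_u,j_v)}w_p^{a,t}\ge\sum_{r}\sum_{p\in P^r}b^r_{p,(i_u,j_v)}\bar y_p^r$ for all $(i_u,j_v)\in E$; $\sum_{p\in P^{a,t}}w_p^{a,t}\le n_{a,t}$ for all $a$ and $t\in T_a$. **The system $Ax=b_{\bar y}$.** Let $E_1=\{(i_u,j_v)\in E:\sum_{r}\sum_{p\in P^r}b^r_{p,(i_u,j_v)}\bar y_p^r=1\}$. For fixed $(a,t)$ and $x=(w_p^{a,t})_{p\in P^{a,t}}$, the system $Ax=b_{\bar y}$ consists of the equations $\sum_{p\in P^{a,t}}a^{a,t}_{p,j_v dep}w_p^{a,t}=\sum_{r}\sum_{p\in P^r}a^r_{p,j_v}\bar y_p^r$ for $j_v\in FC^{a,t}_{dep}$; $\sum_{p\in P^{a,t}}a^{a,t}_{p,j_v arr}w_p^{a,t}=\sum_{r}\sum_{p\in P^r}a^r_{p,j_v}\bar y_p^r$ for $j_v\in FC^{a,t}_{arr}$; $\sum_{p\in P^{a,t}}b^{a,t}_{p,(i_u,j_v)}w_p^{a,t}=1$ for $(i_u,j_v)\in E^{a,t}\cap E_1$. Thus each column of $A$ corresponds to one pattern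 $p\in P^{a,t}$, and $X_{a,t}$ is the feasible region of the linear relaxation of the part of the BSP belonging to $(a,t)$; $\bar X_{a,t}$ is its restriction to the patterns in $\bar P^{a,t}$. **Phase one problem P1LR-RtBSP (for $(a,t)$).** The linear program that minimizes the total constraint violation of $\bar X_{a,t}$ by artificial variables: minimize $\mathbf 1^Ts^++\mathbf 1^Ts^-$ subject to $\bar A\bar x+s^+-s^-=b_{\bar y}$, $\mathbf 1^T\bar x\le n_{a,t}$, $\bar x,s^+,s^-\succeq0$. The sign convention for its dual variables is: $\delta\ge0$, and the reduced cost of a column $\alpha$ is $-\lambda^T\alpha+\delta$; so the dual variables $(\bar\lambda,\bar\delta)$ satisfy $\bar\delta\ge0$ and $\bar\lambda^T\alpha-\bar\delta\le0$ for every $\alpha\in col(\bar A)$. *)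

theory Defs
  imports "HOL-Analysis.Analysis" "HOL-Library.Sublist"
begin

text \<open>
  Decision variables and matrices indexed by finite sets are modelled as functions on the index
  types; only their values on the relevant (finite) index sets enter the constraints.
\<close>

record 'x min_problem =
  feasible_set :: "'x set"
  objective :: "'x \<Rightarrow> real"

definition infeasible :: "'x min_problem \<Rightarrow> bool" where
  "infeasible Q \<longleftrightarrow> feasible_set Q = {}"

record ('v, 'e, 'i) lin_prog =
  lp_vars :: "'v set"
  lp_cost :: "'v \<Rightarrow> real"
  eq_rows :: "'e set"
  eq_coeff :: "'e \<Rightarrow> 'v \<Rightarrow> real"
  eq_rhs :: "'e \<Rightarrow> real"
  le_rows :: "'i set"
  le_coeff :: "'i \<Rightarrow> 'v \<Rightarrow> real"
  le_rhs :: "'i \<Rightarrow> real"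

definition lp_problem :: "('v, 'e, 'i) lin_prog \<Rightarrow> ('v \<Rightarrow> real) min_problem" where
  "lp_problem L = \<lparr>
     feasible_set = {x. (\<forall>v\<in>lp_vars L. 0 \<le> x v)
       \<and> (\<forall>e\<in>eq_rows L. (\<Sum>v\<in>lp_vars L. eq_coeff L e v * x v) = eq_rhs L e)
       \<and> (\<forall>i\<in>le_rows L. (\<Sum>v\<in>lp_vars L. le_coeff L i v * x v) \<le> le_rhs L i)},
     objective = (\<lambda>x. \<Sum>v\<in>lp_vars L. lp_cost L v * x v) \<rparr>"

text \<open>
  The reduced cost adds the \<open>\<le>\<close> rows with their multipliers \<open>del\<close>, so dual feasibility means
  \<open>del \<ge> 0\<close>; the multipliers \<open>lam\<close> of the equations are free.
\<close>

definition reduced_cost ::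
  "('v, 'e, 'i) lin_prog \<Rightarrow> ('e \<Rightarrow> real) \<Rightarrow> ('i \<Rightarrow> real) \<Rightarrow> 'v \<Rightarrow> real" where
  "reduced_cost L lam del v =
     lp_cost L v - (\<Sum>e\<in>eq_rows L. lam e * eq_coeff L e v) + (\<Sum>i\<in>le_rows L. del i * le_coeff L i v)"

definition dual_feasible ::
  "('v, 'e, 'i) lin_prog \<Rightarrow> ('e \<Rightarrow> real) \<Rightarrow> ('i \<Rightarrow> real) \<Rightarrow> bool" where
  "dual_feasible L lam del \<longleftrightarrow>
     (\<forall>i\<in>le_rows L. 0 \<le> del i) \<and> (\<forall>v\<in>lp_vars L. 0 \<le> reduced_cost L lam del v)"

definition dual_objective ::
  "('v, 'e, 'i) lin_prog \<Rightarrow> ('e \<Rightarrow> real) \<Rightarrow> ('i \<Rightarrow> real) \<Rightarrow> real" where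
  "dual_objective L lam del =
     (\<Sum>e\<in>eq_rows L. lam e * eq_rhs L e) - (\<Sum>i\<in>le_rows L. del i * le_rhs L i)"

definition dual_optimal ::
  "('v, 'e, 'i) lin_prog \<Rightarrow> ('e \<Rightarrow> real) \<Rightarrow> ('i \<Rightarrow> real) \<Rightarrow> bool" where
  "dual_optimal L lam del \<longleftrightarrow> dual_feasible L lam del
     \<and> (\<forall>lam' del'. dual_feasible L lam' del' \<longrightarrow> dual_objective L lam' del' \<le> dual_objective L lam del)"

lemma weak_duality:
  assumes x: "x \<in> feasible_set (lp_problem L)" and d: "dual_feasible L lam del"
  shows "dual_objective L lam del \<le> objective (lp_problem L) x"
proof -
  let ?V = "lp_vars L" and ?E = "eq_rows L" and ?I = "le_rows L"
  have "(\<Sum>e\<in>?E. lam e * eq_rhs L e) = (\<Sum>e\<in>?E. lam e * (\<Sum>v\<in>?V. eq_coeff L e v * x v))"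
    using x by (intro sum.cong) (auto simp: lp_problem_def)
  also have "\<dots> = (\<Sum>v\<in>?V. (\<Sum>e\<in>?E. lam e * eq_coeff L e v) * x v)"
    unfolding sum_distrib_left sum_distrib_right by (subst sum.swap) (simp add: mult.assoc)
  finally have 1: "(\<Sum>e\<in>?E. lam e * eq_rhs L e) = \<dots>" .
  have "(\<Sum>v\<in>?V. (\<Sum>i\<in>?I. del i * le_coeff L i v) * x v)
      = (\<Sum>i\<in>?I. del i * (\<Sum>v\<in>?V. le_coeff L i v * x v))"
    unfolding sum_distrib_left sum_distrib_right by (subst sum.swap) (simp add: mult.assoc)
  also have "\<dots> \<le> (\<Sum>i\<in>?I. del i * le_rhs L i)"
    using x d by (intro sum_mono mult_left_mono) (auto simp: lp_problem_def dual_feasible_def)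
  finally have 2: "(\<Sum>v\<in>?V. (\<Sum>i\<in>?I. del i * le_coeff L i v) * x v) \<le> \<dots>" .
  have "0 \<le> (\<Sum>v\<in>?V. reduced_cost L lam del v * x v)"
    using x d by (intro sum_nonneg mult_nonneg_nonneg) (auto simp: lp_problem_def dual_feasible_def)
  also have "\<dots> = (\<Sum>v\<in>?V. lp_cost L v * x v)
      - (\<Sum>v\<in>?V. (\<Sum>e\<in>?E. lam e * eq_coeff L e v) * x v)
      + (\<Sum>v\<in>?V. (\<Sum>i\<in>?I. del i * le_coeff L i v) * x v)"
    by (simp add: reduced_cost_def algebra_simps sum.distrib sum_subtractf)
  finally show ?thesis
    using 1 2 by (simp add: dual_objective_def lp_problem_def)
qed

datatype 'c activity = Dep 'c | Arr 'c

record ('f, 'c, 's, 'r, 'a, 't) recovery =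
  slots :: "'s set"
  flights :: "'f set"
  copies :: "'f \<Rightarrow> 'c set"
  connections :: "('c \<times> 'c) set"
  aircraft :: "'r set"
  routes :: "'r \<Rightarrow> 'c list set"
  airports :: "'a set"
  gate_types :: "'a \<Rightarrow> 't set"
  patterns :: "'a \<Rightarrow> 't \<Rightarrow> 'c activity list set"
  dep_copies :: "'a \<Rightarrow> 't \<Rightarrow> 'c set"
  arr_copies :: "'a \<Rightarrow> 't \<Rightarrow> 'c set"
  gate_connections :: "'a \<Rightarrow> 't \<Rightarrow> ('c \<times> 'c) set"
  departs_in :: "'c \<Rightarrow> 's \<Rightarrow> bool"
  arrives_in :: "'c \<Rightarrow> 's \<Rightarrow> bool"
  dep_capacity :: "'s \<Rightarrow> real"
  arr_capacity :: "'s \<Rightarrow> real"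
  cancel_cost :: "'f \<Rightarrow> real"
  route_cost :: "'r \<Rightarrow> 'c list \<Rightarrow> real"
  pattern_cost :: "'a \<Rightarrow> 't \<Rightarrow> real"
  num_gates :: "'a \<Rightarrow> 't \<Rightarrow> nat"

definition all_copies :: "('f, 'c, 's, 'r, 'a, 't) recovery \<Rightarrow> 'c set" where
  "all_copies I = (\<Union>j\<in>flights I. copies I j)"

definition gates :: "('f, 'c, 's, 'r, 'a, 't) recovery \<Rightarrow> ('a \<times> 't) set" where
  "gates I = Sigma (airports I) (gate_types I)"

definition partitioned_by :: "'x set \<Rightarrow> 'i set \<Rightarrow> ('i \<Rightarrow> 'x set) \<Rightarrow> bool" where
  "partitioned_by X K Y \<longleftrightarrow> (\<Union>k\<in>K. Y k) = X \<and> disjoint_family_on Y K"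

text \<open>\<open>sublist [u, v] p\<close> says that \<open>v\<close> immediately follows \<open>u\<close> in the sequence \<open>p\<close>.\<close>

definition well_formed :: "('f, 'c, 's, 'r, 'a, 't) recovery \<Rightarrow> bool" where
  "well_formed I \<longleftrightarrow>
     finite (slots I) \<and> finite (flights I) \<and> (\<forall>j\<in>flights I. finite (copies I j))
   \<and> finite (aircraft I) \<and> (\<forall>r\<in>aircraft I. finite (routes I r))
   \<and> finite (airports I) \<and> (\<forall>a\<in>airports I. finite (gate_types I a))
   \<and> (\<forall>(a, t)\<in>gates I. finite (patterns I a t))
   \<and> disjoint_family_on (copies I) (flights I)
   \<and> connections I \<subseteq> all_copies I \<times> all_copies I
   \<and> (\<forall>r\<in>aircraft I. \<forall>p\<in>routes I r. set p \<subseteq> all_copies I)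
   \<and> partitioned_by (all_copies I) (gates I) (\<lambda>(a, t). dep_copies I a t)
   \<and> partitioned_by (all_copies I) (gates I) (\<lambda>(a, t). arr_copies I a t)
   \<and> partitioned_by (connections I) (gates I) (\<lambda>(a, t). gate_connections I a t)
   \<and> (\<forall>(a, t)\<in>gates I. \<forall>p\<in>patterns I a t.
        (\<forall>v. Dep v \<in> set p \<longrightarrow> v \<in> dep_copies I a t)
      \<and> (\<forall>v. Arr v \<in> set p \<longrightarrow> v \<in> arr_copies I a t)
      \<and> (\<forall>u v. sublist [Arr u, Dep v] p \<longrightarrow> (u, v) \<in> gate_connections I a t))"

definition route_uses :: "'c list \<Rightarrow> 'c \<Rightarrow> real" where
  "route_uses p v = of_bool (v \<in> set p)"

definition route_connects :: "'c list \<Rightarrow> 'c \<times> 'c \<Rightarrow> real" where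
  "route_connects p e = of_bool (sublist [fst e, snd e] p)"

definition pattern_dep :: "'c activity list \<Rightarrow> 'c \<Rightarrow> real" where
  "pattern_dep p v = of_bool (Dep v \<in> set p)"

definition pattern_arr :: "'c activity list \<Rightarrow> 'c \<Rightarrow> real" where
  "pattern_arr p v = of_bool (Arr v \<in> set p)"

definition pattern_connects :: "'c activity list \<Rightarrow> 'c \<times> 'c \<Rightarrow> real" where
  "pattern_connects p e = of_bool (sublist [Arr (fst e), Dep (snd e)] p)"

definition copy_use ::
  "('f, 'c, 's, 'r, 'a, 't) recovery \<Rightarrow> ('r \<Rightarrow> 'c list \<Rightarrow> real) \<Rightarrow> 'c \<Rightarrow> real" where
  "copy_use I y v = (\<Sum>r\<in>aircraft I. \<Sum>p\<in>routes I r. route_uses p v * y r p)"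

definition connection_use ::
  "('f, 'c, 's, 'r, 'a, 't) recovery \<Rightarrow> ('r \<Rightarrow> 'c list \<Rightarrow> real) \<Rightarrow> 'c \<times> 'c \<Rightarrow> real" where
  "connection_use I y e = (\<Sum>r\<in>aircraft I. \<Sum>p\<in>routes I r. route_connects p e * y r p)"

text \<open>
  A cut \<open>(\<alpha>, \<beta>, \<gamma>)\<close> is the linear inequality in \<open>y\<close> and \<open>q\<close> whose coefficients are \<open>\<alpha>\<close> and \<open>\<beta>\<close>
  and whose left-hand side is bounded from below by \<open>\<gamma>\<close>.
\<close>

type_synonym ('c, 'r) cut = "('r \<Rightarrow> 'c list \<Rightarrow> real) \<times> real \<times> real"

definition RxBMP ::
  "('f, 'c, 's, 'r, 'a, 't) recovery \<Rightarrow> ('c, 'r) cut set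
    \<Rightarrow> (('f \<Rightarrow> real) \<times> ('r \<Rightarrow> 'c list \<Rightarrow> real) \<times> real) min_problem" where
  "RxBMP I cuts = \<lparr>
     feasible_set = {(z, y, q).
         (\<forall>j\<in>flights I. z j \<in> {0, 1})
       \<and> (\<forall>r\<in>aircraft I. \<forall>p\<in>routes I r. y r p \<in> {0, 1})
       \<and> 0 \<le> q
       \<and> (\<forall>j\<in>flights I.
            (\<Sum>r\<in>aircraft I. \<Sum>p\<in>routes I r. \<Sum>v\<in>copies I j. route_uses p v * y r p) + z j = 1)
       \<and> (\<forall>s\<in>slots I.
            (\<Sum>r\<in>aircraft I. \<Sum>p\<in>routes I r. \<Sum>j\<in>flights I. \<Sum>v\<in>copies I j.
               of_bool (v \<in> set p \<and> departs_in I v s) * y r p) \<le> dep_capacity I s)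
       \<and> (\<forall>s\<in>slots I.
            (\<Sum>r\<in>aircraft I. \<Sum>p\<in>routes I r. \<Sum>j\<in>flights I. \<Sum>v\<in>copies I j.
               of_bool (v \<in> set p \<and> arrives_in I v s) * y r p) \<le> arr_capacity I s)
       \<and> (\<forall>r\<in>aircraft I. (\<Sum>p\<in>routes I r. y r p) \<le> 1)
       \<and> (\<forall>(\<alpha>, \<beta>, \<gamma>)\<in>cuts.
            (\<Sum>r\<in>aircraft I. \<Sum>p\<in>routes I r. \<alpha> r p * y r p) + \<beta> * q \<ge> \<gamma>)},
     objective = (\<lambda>(z, y, q). (\<Sum>j\<in>flights I. cancel_cost I j * z j)
       + (\<Sum>r\<in>aircraft I. \<Sum>p\<in>routes I r. route_cost I r p * y r p) + q) \<rparr>"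

definition BSP ::
  "('f, 'c, 's, 'r, 'a, 't) recovery \<Rightarrow> ('r \<Rightarrow> 'c list \<Rightarrow> real)
    \<Rightarrow> ('a \<Rightarrow> 't \<Rightarrow> 'c activity list \<Rightarrow> real) min_problem" where
  "BSP I y = \<lparr>
     feasible_set = {w.
         (\<forall>a\<in>airports I. \<forall>t\<in>gate_types I a. \<forall>p\<in>patterns I a t. w a t p \<in> {0, 1})
       \<and> (\<forall>j\<in>flights I. \<forall>v\<in>copies I j.
            (\<Sum>a\<in>airports I. \<Sum>t\<in>gate_types I a. \<Sum>p\<in>patterns I a t. pattern_dep p v * w a t p)
              = copy_use I y v)
       \<and> (\<forall>j\<in>flights I. \<forall>v\<in>copies I j.
            (\<Sum>a\<in>airports I. \<Sum>t\<in>gate_types I a. \<Sum>p\<in>patterns I a t. pattern_arr p v * w a t p)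
              = copy_use I y v)
       \<and> (\<forall>e\<in>connections I.
            (\<Sum>a\<in>airports I. \<Sum>t\<in>gate_types I a. \<Sum>p\<in>patterns I a t. pattern_connects p e * w a t p)
              \<ge> connection_use I y e)
       \<and> (\<forall>a\<in>airports I. \<forall>t\<in>gate_types I a.
            (\<Sum>p\<in>patterns I a t. w a t p) \<le> real (num_gates I a t))},
     objective = (\<lambda>w. \<Sum>a\<in>airports I. \<Sum>t\<in>gate_types I a. \<Sum>p\<in>patterns I a t.
                    pattern_cost I a t * w a t p) \<rparr>"

definition E1 ::
  "('f, 'c, 's, 'r, 'a, 't) recovery \<Rightarrow> ('r \<Rightarrow> 'c list \<Rightarrow> real) \<Rightarrow> ('c \<times> 'c) set" where
  "E1 I y = {e \<in> connections I. connection_use I y e = 1}"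

datatype 'c row = Dep_row 'c | Arr_row 'c | Conn_row "'c \<times> 'c"

definition system_rows ::
  "('f, 'c, 's, 'r, 'a, 't) recovery \<Rightarrow> ('r \<Rightarrow> 'c list \<Rightarrow> real) \<Rightarrow> 'a \<Rightarrow> 't \<Rightarrow> 'c row set" where
  "system_rows I y a t = Dep_row ` dep_copies I a t \<union> Arr_row ` arr_copies I a t
                  \<union> Conn_row ` (gate_connections I a t \<inter> E1 I y)"

fun system_entry :: "'c row \<Rightarrow> 'c activity list \<Rightarrow> real" where
  "system_entry (Dep_row v) p = pattern_dep p v"
| "system_entry (Arr_row v) p = pattern_arr p v"
| "system_entry (Conn_row e) p = pattern_connects p e"

fun system_rhs ::
  "('f, 'c, 's, 'r, 'a, 't) recovery \<Rightarrow> ('r \<Rightarrow> 'c list \<Rightarrow> real) \<Rightarrow> 'c row \<Rightarrow> real" where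
  "system_rhs I y (Dep_row v) = copy_use I y v"
| "system_rhs I y (Arr_row v) = copy_use I y v"
| "system_rhs I y (Conn_row e) = 1"

text \<open>
  \<open>cols I y a t Q\<close> is the set of columns, as vectors indexed by \<open>system_rows I y a t\<close>,
  of the matrix whose columns correspond to the patterns in \<open>Q\<close>. It is a set of vectors, so
  patterns inside and outside \<open>Q\<close> may share a column.
\<close>

definition cols ::
  "('f, 'c, 's, 'r, 'a, 't) recovery \<Rightarrow> ('r \<Rightarrow> 'c list \<Rightarrow> real) \<Rightarrow> 'a \<Rightarrow> 't
    \<Rightarrow> 'c activity list set \<Rightarrow> ('c row \<Rightarrow> real) set" where
  "cols I y a t Q = (\<lambda>p. \<lambda>i\<in>system_rows I y a t. system_entry i p) ` Q"

definition relaxation ::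
  "('f, 'c, 's, 'r, 'a, 't) recovery \<Rightarrow> ('r \<Rightarrow> 'c list \<Rightarrow> real) \<Rightarrow> 'a \<Rightarrow> 't
    \<Rightarrow> 'c activity list set \<Rightarrow> ('c activity list \<Rightarrow> real) set" where
  "relaxation I y a t Q = {x.
       (\<forall>i\<in>system_rows I y a t. (\<Sum>p\<in>Q. system_entry i p * x p) = system_rhs I y i)
     \<and> (\<Sum>p\<in>Q. x p) \<le> real (num_gates I a t)
     \<and> (\<forall>p\<in>Q. 0 \<le> x p)}"

datatype 'c p1_var = is_Pat: Pat "'c activity list" | Splus "'c row" | Sminus "'c row"

fun p1_coeff :: "'c row \<Rightarrow> 'c p1_var \<Rightarrow> real" where
  "p1_coeff i (Pat p) = system_entry i p"
| "p1_coeff i (Splus k) = of_bool (k = i)"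
| "p1_coeff i (Sminus k) = - of_bool (k = i)"

definition P1LR ::
  "('f, 'c, 's, 'r, 'a, 't) recovery \<Rightarrow> ('r \<Rightarrow> 'c list \<Rightarrow> real) \<Rightarrow> 'a \<Rightarrow> 't
    \<Rightarrow> 'c activity list set \<Rightarrow> ('c p1_var, 'c row, unit) lin_prog" where
  "P1LR I y a t Q = \<lparr>
     lp_vars = Pat ` Q \<union> Splus ` system_rows I y a t \<union> Sminus ` system_rows I y a t,
     lp_cost = (\<lambda>v. of_bool (\<not> is_Pat v)),
     eq_rows = system_rows I y a t,
     eq_coeff = p1_coeff,
     eq_rhs = system_rhs I y,
     le_rows = {()},
     le_coeff = (\<lambda>_ v. of_bool (is_Pat v)),
     le_rhs = (\<lambda>_. real (num_gates I a t)) \<rparr>"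

lemma finite_system_rows:
  assumes "well_formed I" "(a, t) \<in> gates I"
  shows "finite (system_rows I y a t)"
proof -
  have fin: "finite (all_copies I)"
    using assms(1) by (auto simp: well_formed_def all_copies_def)
  then have "finite (connections I)"
    using assms(1) finite_subset[of "connections I" "all_copies I \<times> all_copies I"]
    by (auto simp: well_formed_def)
  then have "finite (E1 I y)" by (simp add: E1_def)
  moreover have "dep_copies I a t \<subseteq> all_copies I" "arr_copies I a t \<subseteq> all_copies I"
    using assms by (auto simp: well_formed_def partitioned_by_def)
  then have "finite (dep_copies I a t)" "finite (arr_copies I a t)"
    using fin finite_subset by auto
  ultimately show ?thesis by (simp add: system_rows_def)
qed

lemma P1LR_dual_feasible_iff:
  assumes "finite (system_rows I y a t)"
  shows "dual_feasible (P1LR I y a t Q) lam (\<lambda>_. del) \<longleftrightarrow>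
           0 \<le> del
         \<and> (\<forall>\<alpha>\<in>cols I y a t Q. (\<Sum>i\<in>system_rows I y a t. lam i * \<alpha> i) - del \<le> 0)
         \<and> (\<forall>i\<in>system_rows I y a t. \<bar>lam i\<bar> \<le> 1)"
proof -
  let ?R = "system_rows I y a t"
  have s: "(\<Sum>i\<in>?R. lam i * of_bool (k = i)) = lam k" if "k \<in> ?R" for k
  proof -
    have "(\<Sum>i\<in>?R. lam i * of_bool (k = i)) = (\<Sum>i\<in>?R. if i = k then lam i else 0)"
      by (intro sum.cong) auto
    with that assms show ?thesis by simp
  qed
  have c: "(\<Sum>i\<in>?R. lam i * restrict (\<lambda>i. system_entry i p) ?R i) = (\<Sum>i\<in>?R. lam i * system_entry i p)" for p
    by (intro sum.cong) auto
  show ?thesis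
    by (auto simp: dual_feasible_def reduced_cost_def P1LR_def cols_def ball_Un s c
      sum_negf abs_le_iff)
qed

end

theory Submission
  imports Defs
begin

text \<open>
  The vector \<open>lam\<close> and the number \<open>delhat\<close> form a Farkas certificate for the full system at the gate
  \<open>(a, t)\<close>. Dual feasibility in the restricted phase one problem prices the columns present there
  by at most \<open>del\<close>, and the maximum that defines \<open>delhat\<close> covers all the remaining columns. Hence
  \<open>lam\<close> prices every pattern by at most \<open>delhat\<close>, where \<open>delhat \<ge> del \<ge> 0\<close>. A nonnegative solution
  using at most \<open>num_gates\<close> units of patterns would then give
  \<open>lam \<bullet> b \<le> num_gates * delhat\<close> (lemma \<open>relaxation_empty_if_certificate\<close>).

  The Benders subproblem inherits the infeasibility because its restriction to the patterns of
  one gate solves the system of that gate (lemma \<open>BSP_restricts_to_relaxation\<close>). There are two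
  points. Copies and connections are partitioned among the gates, so the sums over all gates in
  the subproblem reduce to sums over the patterns of one gate. Moreover, the subproblem only asks
  that a connection be served \<^emph>\<open>at least\<close> as often as it is flown, whereas the system has an
  equation. The converse inequality comes from the master problem: a flight is flown at most once,
  and a pattern that serves a connection also contains the departure of its second copy.
\<close>

lemma relaxation_empty_if_certificate:
  assumes nonneg: "0 \<le> d"
    and price: "\<And>p. p \<in> Q \<Longrightarrow> (\<Sum>i\<in>system_rows I y a t. lam i * system_entry i p) \<le> d"
    and pos: "(\<Sum>i\<in>system_rows I y a t. lam i * system_rhs I y i) - real (num_gates I a t) * d > 0"
  shows "relaxation I y a t Q = {}"
proof (rule equals0I)
  fix x assume x: "x \<in> relaxation I y a t Q"
  let ?R = "system_rows I y a t"
  have "(\<Sum>i\<in>?R. lam i * system_rhs I y i) = (\<Sum>i\<in>?R. lam i * (\<Sum>p\<in>Q. system_entry i p * x p))"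
    using x by (intro sum.cong) (auto simp: relaxation_def)
  also have "\<dots> = (\<Sum>p\<in>Q. (\<Sum>i\<in>?R. lam i * system_entry i p) * x p)"
    unfolding sum_distrib_left sum_distrib_right by (subst sum.swap) (simp add: mult.assoc)
  also have "\<dots> \<le> (\<Sum>p\<in>Q. d * x p)"
    using x price by (intro sum_mono mult_right_mono) (auto simp: relaxation_def)
  also have "\<dots> = d * (\<Sum>p\<in>Q. x p)"
    by (simp add: sum_distrib_left)
  also have "\<dots> \<le> d * real (num_gates I a t)"
    using x nonneg by (intro mult_left_mono) (auto simp: relaxation_def)
  finally show False
    using pos by (simp add: mult.commute)
qed

lemma partitioned_by_unique:
  assumes "partitioned_by X K Y" "k \<in> K" "l \<in> K" "x \<in> Y k" "x \<in> Y l"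
  shows "k = l"
  using assms by (auto simp: partitioned_by_def disjoint_family_on_def)

text \<open>
  Each kind of coefficient vanishes on the patterns of all gates other than the one owning the
  copy or connection, so that only a single gate contributes to a row of the subproblem.
\<close>

lemma sum_over_gates_eq_single:
  fixes g :: "'a \<Rightarrow> 't \<Rightarrow> 'c activity list \<Rightarrow> real"
  assumes wf: "well_formed I" and at: "a \<in> airports I" "t \<in> gate_types I a"
    and zero: "\<And>a' t' p. (a', t') \<in> gates I \<Longrightarrow> (a', t') \<noteq> (a, t) \<Longrightarrow> p \<in> patterns I a' t'
                 \<Longrightarrow> g a' t' p = 0"
  shows "(\<Sum>a\<in>airports I. \<Sum>t\<in>gate_types I a. \<Sum>p\<in>patterns I a t. g a t p)
           = (\<Sum>p\<in>patterns I a t. g a t p)"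
proof -
  have fin: "finite (airports I)" "\<forall>a\<in>airports I. finite (gate_types I a)"
    using wf by (auto simp: well_formed_def)
  have "(\<Sum>a\<in>airports I. \<Sum>t\<in>gate_types I a. \<Sum>p\<in>patterns I a t. g a t p)
      = (\<Sum>(a, t)\<in>gates I. \<Sum>p\<in>patterns I a t. g a t p)"
    using fin by (simp add: gates_def sum.Sigma)
  also have "\<dots> = (\<Sum>(a, t)\<in>{(a, t)}. \<Sum>p\<in>patterns I a t. g a t p)"
    using fin at zero by (intro sum.mono_neutral_right) (auto simp: gates_def intro!: sum.neutral)
  finally show ?thesis by simp
qed

lemma pattern_connects_le_dep: "pattern_connects p (u, v) \<le> pattern_dep p v"
  by (auto simp: pattern_connects_def pattern_dep_def dest: set_mono_sublist)

text \<open>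
  This is where the master problem enters: by its covering equation, at most one copy of each
  flight is flown, and at most once.
\<close>

lemma RxBMP_copy_use_le_1:
  assumes wf: "well_formed I" and yf: "(z, y, q) \<in> feasible_set (RxBMP I cuts)"
    and v: "v \<in> all_copies I"
  shows "copy_use I y v \<le> 1"
proof -
  obtain j where j: "j \<in> flights I" "v \<in> copies I j"
    using v by (auto simp: all_copies_def)
  have fin: "finite (copies I j)"
    using wf j by (auto simp: well_formed_def)
  have y01: "y r p \<in> {0, 1}" if "r \<in> aircraft I" "p \<in> routes I r" for r p
    using yf that by (auto simp: RxBMP_def)
  have "copy_use I y v
      \<le> (\<Sum>r\<in>aircraft I. \<Sum>p\<in>routes I r. \<Sum>v\<in>copies I j. route_uses p v * y r p)"
    unfolding copy_use_def
  proof (intro sum_mono)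
    fix r p assume "r \<in> aircraft I" "p \<in> routes I r"
    then have "0 \<le> y r p" using y01 by force
    then show "route_uses p v * y r p \<le> (\<Sum>v\<in>copies I j. route_uses p v * y r p)"
      using j fin by (intro member_le_sum) (auto simp: route_uses_def)
  qed
  moreover have "(\<Sum>r\<in>aircraft I. \<Sum>p\<in>routes I r. \<Sum>v\<in>copies I j. route_uses p v * y r p) + z j = 1"
    and "z j \<in> {0, 1}"
    using yf j by (auto simp: RxBMP_def)
  ultimately show ?thesis by auto
qed

lemma BSP_restricts_to_relaxation:
  assumes wf: "well_formed I" and yf: "(z, y, q) \<in> feasible_set (RxBMP I cuts)"
    and at: "a \<in> airports I" "t \<in> gate_types I a"
    and w: "w \<in> feasible_set (BSP I y)"
  shows "w a t \<in> relaxation I y a t (patterns I a t)"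
proof -
  have gate: "(a, t) \<in> gates I" using at by (simp add: gates_def)
  have w0: "0 \<le> w a t p" if "(a, t) \<in> gates I" "p \<in> patterns I a t" for a t p
  proof -
    have "w a t p \<in> {0, 1}" using w that by (simp add: BSP_def gates_def)
    then show ?thesis by auto
  qed
  have dep_part: "partitioned_by (all_copies I) (gates I) (\<lambda>(a, t). dep_copies I a t)"
    and arr_part: "partitioned_by (all_copies I) (gates I) (\<lambda>(a, t). arr_copies I a t)"
    and conn_part: "partitioned_by (connections I) (gates I) (\<lambda>(a, t). gate_connections I a t)"
    and conn_sub: "connections I \<subseteq> all_copies I \<times> all_copies I"
    using wf unfolding well_formed_def by blast+
  have contents: "\<forall>(a, t)\<in>gates I. \<forall>p\<in>patterns I a t.
        (\<forall>v. Dep v \<in> set p \<longrightarrow> v \<in> dep_copies I a t)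
      \<and> (\<forall>v. Arr v \<in> set p \<longrightarrow> v \<in> arr_copies I a t)
      \<and> (\<forall>u v. sublist [Arr u, Dep v] p \<longrightarrow> (u, v) \<in> gate_connections I a t)"
    using wf unfolding well_formed_def by blast
  have owner: "Dep v \<in> set p \<Longrightarrow> v \<in> dep_copies I a t"
      "Arr v \<in> set p \<Longrightarrow> v \<in> arr_copies I a t"
      "sublist [Arr u, Dep v] p \<Longrightarrow> (u, v) \<in> gate_connections I a t"
    if "(a, t) \<in> gates I" "p \<in> patterns I a t" for a t p u v
    using contents that by (auto simp: case_prod_unfold)

  have dep_total: "(\<Sum>a\<in>airports I. \<Sum>t\<in>gate_types I a. \<Sum>p\<in>patterns I a t.
      pattern_dep p v * w a t p) = copy_use I y v"
    and arr_total: "(\<Sum>a\<in>airports I. \<Sum>t\<in>gate_types I a. \<Sum>p\<in>patterns I a t.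
      pattern_arr p v * w a t p) = copy_use I y v" if "v \<in> all_copies I" for v
    using w that by (simp_all add: BSP_def all_copies_def) blast+

  have "(\<Sum>p\<in>patterns I a t. system_entry i p * w a t p) = system_rhs I y i"
    if i: "i \<in> system_rows I y a t" for i
  proof (cases i)
    case (Dep_row v)
    then have v: "v \<in> dep_copies I a t" using i by (auto simp: system_rows_def)
    then have "v \<in> all_copies I" using dep_part gate by (auto simp: partitioned_by_def)
    moreover have "(\<Sum>a\<in>airports I. \<Sum>t\<in>gate_types I a. \<Sum>p\<in>patterns I a t. pattern_dep p v * w a t p)
        = (\<Sum>p\<in>patterns I a t. pattern_dep p v * w a t p)"
    proof (rule sum_over_gates_eq_single[OF wf at])
      fix a' t' p assume "(a', t') \<in> gates I" "(a', t') \<noteq> (a, t)" "p \<in> patterns I a' t'"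
      then show "pattern_dep p v * w a' t' p = 0"
        using owner(1)[of a' t' p v] v gate partitioned_by_unique[OF dep_part, of "(a', t')" "(a, t)" v]
        by (auto simp: pattern_dep_def)
    qed
    ultimately show ?thesis using Dep_row dep_total by simp
  next
    case (Arr_row v)
    then have v: "v \<in> arr_copies I a t" using i by (auto simp: system_rows_def)
    then have "v \<in> all_copies I" using arr_part gate by (auto simp: partitioned_by_def)
    moreover have "(\<Sum>a\<in>airports I. \<Sum>t\<in>gate_types I a. \<Sum>p\<in>patterns I a t. pattern_arr p v * w a t p)
        = (\<Sum>p\<in>patterns I a t. pattern_arr p v * w a t p)"
    proof (rule sum_over_gates_eq_single[OF wf at])
      fix a' t' p assume "(a', t') \<in> gates I" "(a', t') \<noteq> (a, t)" "p \<in> patterns I a' t'"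
      then show "pattern_arr p v * w a' t' p = 0"
        using owner(2)[of a' t' p v] v gate partitioned_by_unique[OF arr_part, of "(a', t')" "(a, t)" v]
        by (auto simp: pattern_arr_def)
    qed
    ultimately show ?thesis using Arr_row arr_total by simp
  next
    case (Conn_row e)
    obtain u v where e: "e = (u, v)" by (cases e)
    have uv: "(u, v) \<in> gate_connections I a t" "(u, v) \<in> connections I" "connection_use I y (u, v) = 1"
      using i Conn_row e by (auto simp: system_rows_def E1_def)
    have vc: "v \<in> all_copies I" using uv conn_sub by auto
    let ?total = "\<Sum>a\<in>airports I. \<Sum>t\<in>gate_types I a. \<Sum>p\<in>patterns I a t.
      pattern_connects p (u, v) * w a t p"
    have "?total = (\<Sum>p\<in>patterns I a t. pattern_connects p (u, v) * w a t p)"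
    proof (rule sum_over_gates_eq_single[OF wf at])
      fix a' t' p assume "(a', t') \<in> gates I" "(a', t') \<noteq> (a, t)" "p \<in> patterns I a' t'"
      then show "pattern_connects p (u, v) * w a' t' p = 0"
        using owner(3)[of a' t' p u v] uv gate
          partitioned_by_unique[OF conn_part, of "(a', t')" "(a, t)" "(u, v)"]
        by (auto simp: pattern_connects_def)
    qed
    moreover have "?total \<ge> connection_use I y (u, v)"
      using w uv(2) by (simp add: BSP_def)
    (* A priori the departure of v may belong to a gate other than (a, t), hence the comparison
       of the totals over all gates instead of the sums at (a, t). *)
    moreover have "?total \<le> (\<Sum>a\<in>airports I. \<Sum>t\<in>gate_types I a. \<Sum>p\<in>patterns I a t.
        pattern_dep p v * w a t p)"
      using w0 by (intro sum_mono mult_right_mono pattern_connects_le_dep) (auto simp: gates_def)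
    ultimately show ?thesis
      using dep_total[OF vc] RxBMP_copy_use_le_1[OF wf yf vc] uv(3) Conn_row e by simp
  qed
  moreover have "(\<Sum>p\<in>patterns I a t. w a t p) \<le> real (num_gates I a t)"
    using w at by (simp add: BSP_def)
  ultimately show ?thesis
    using w0[OF gate] by (simp add: relaxation_def)
qed

theorem theorem1:
  fixes I :: "('f, 'c, 's, 'r, 'a, 't) recovery"
    and cuts :: "('c, 'r) cut set"
    and z :: "'f \<Rightarrow> real" and y :: "'r \<Rightarrow> 'c list \<Rightarrow> real" and q :: real
    and a :: 'a and t :: 't
    and Pbar :: "'c activity list set"
    and lam :: "'c row \<Rightarrow> real" and del delhat :: real
  assumes "well_formed I"
    and "finite cuts"
    and "(z, y, q) \<in> feasible_set (RxBMP I cuts)"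
    and "a \<in> airports I" and "t \<in> gate_types I a"
    and "Pbar \<subseteq> patterns I a t"
    and "relaxation I y a t Pbar = {}"
    and "dual_optimal (P1LR I y a t Pbar) lam (\<lambda>_. del)"
    and "delhat = Max (insert del ((\<lambda>\<alpha>. \<Sum>i\<in>system_rows I y a t. lam i * \<alpha> i) `
                         (cols I y a t (patterns I a t) - cols I y a t Pbar)))"
    and "(\<Sum>i\<in>system_rows I y a t. lam i * system_rhs I y i) - real (num_gates I a t) * delhat > 0"
  shows "relaxation I y a t (patterns I a t) = {} \<and> infeasible (BSP I y)"
proof -
  let ?R = "system_rows I y a t" and ?P = "patterns I a t"
  let ?price = "\<lambda>\<alpha>. \<Sum>i\<in>?R. lam i * \<alpha> i"
  let ?new = "cols I y a t ?P - cols I y a t Pbar"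
  have gate: "(a, t) \<in> gates I" using assms(4,5) by (simp add: gates_def)
  then have "finite ?P" using assms(1) by (auto simp: well_formed_def)
  then have fin: "finite (insert del (?price ` ?new))" by (simp add: cols_def)
  have dual: "0 \<le> del" "\<And>\<alpha>. \<alpha> \<in> cols I y a t Pbar \<Longrightarrow> ?price \<alpha> \<le> del"
    using assms(8) P1LR_dual_feasible_iff[OF finite_system_rows[OF assms(1) gate]]
    by (auto simp: dual_optimal_def)
  have "del \<le> delhat" unfolding assms(9) using fin by (intro Max_ge) auto
  have price: "?price \<alpha> \<le> delhat" if "\<alpha> \<in> cols I y a t ?P" for \<alpha>
  proof (cases "\<alpha> \<in> cols I y a t Pbar")
    case True
    then show ?thesis using dual(2) \<open>del \<le> delhat\<close> by force
  next
    case False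
    then show ?thesis unfolding assms(9) using fin that by (intro Max_ge) auto
  qed
  have empty: "relaxation I y a t ?P = {}"
  proof (rule relaxation_empty_if_certificate[OF _ _ assms(10)])
    show "0 \<le> delhat" using dual(1) \<open>del \<le> delhat\<close> by simp
  next
    fix p assume "p \<in> ?P"
    then have "restrict (\<lambda>i. system_entry i p) ?R \<in> cols I y a t ?P"
      unfolding cols_def by (rule imageI)
    then have "?price (restrict (\<lambda>i. system_entry i p) ?R) \<le> delhat"
      by (rule price)
    moreover have "?price (restrict (\<lambda>i. system_entry i p) ?R) = (\<Sum>i\<in>?R. lam i * system_entry i p)"
      by (intro sum.cong) auto
    ultimately show "(\<Sum>i\<in>?R. lam i * system_entry i p) \<le> delhat" by simp
  qed
  moreover have "infeasible (BSP I y)"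
    unfolding infeasible_def
    using BSP_restricts_to_relaxation[OF assms(1,3,4,5)] empty by blast
  ultimately show ?thesis by simp
qed

end
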